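(* Let $(P,\leq,{}',0,1)$ be a modular poset with complementation. Then it is pseudo-orthomodular if and only if for all $x,y\in P$, \[L\Big(\bigcap_{z\in L(x,y)}\big(U(z,y')\cup\{y\}\big)\Big)\subseteq\bigcup_{z\in L(x,y)}L\big(U(z,y')\cup\{y\}\big).\]
   Context: For a poset $(P,\leq)$ and $A\subseteq P$ let $L(A)=\{x\in P\mid x\leq y\text{ for all }y\in A\}$ and $U(A)=\{x\in P\mid y\leq x\text{ for all }y\in A\}$; we write $L(a,b)$ for $L(\{a,b\})$, $L(A,a)$ for $L(A\cup\{a\})$, etc., and similarly for $U$. A poset is modular if for all $x,y,z$, $x\leq z$ implies $L(U(x,y),z)=L(U(x,L(y,z)))$ (equivalently $U(x,L(y,z))=U(L(U(x,y),z))$). A poset with complementation is $(P,\leq,{}',0,1)$ with $(P,\leq,0,1)$ a bounded poset and $'$ a unary operation such that $L(x,x')=\{0\}$, $U(x,x')=\{1\}$, $x\leq y$ implies $y'\leq x'$, and $(x')'=x$. A pseudo-orthomodular poset is a poset with complementation satisfying $L(U(L(x,y),y'),y)=L(x,y)$ for all $x,y$. *)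

theory Defs
  imports "HOL-Algebra.Order"
begin

text \<open>
  The cones \<open>L(A)\<close> and \<open>U(A)\<close> are \<^const>\<open>Lower\<close> and \<^const>\<open>Upper\<close>. The least and greatest
  elements are unique, so the constants 0 and 1 of a bounded poset are \<^const>\<open>bottom\<close> and
  \<^const>\<open>top\<close>.
\<close>

locale modular_poset = partial_order P for P (structure) +
  assumes modular:
    "\<lbrakk>x \<in> carrier P; y \<in> carrier P; z \<in> carrier P; x \<sqsubseteq> z\<rbrakk> \<Longrightarrow>
      Lower P (Upper P {x, y} \<union> {z}) = Lower P (Upper P ({x} \<union> Lower P {y, z}))"

locale bounded_poset =
  partial_order P + weak_partial_order_bottom P + weak_partial_order_top P for P (structure)

locale complementation_poset = bounded_poset P for P (structure) +
  fixes compl :: "'a \<Rightarrow> 'a"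
  assumes compl_closed: "x \<in> carrier P \<Longrightarrow> compl x \<in> carrier P"
    and Lower_compl: "x \<in> carrier P \<Longrightarrow> Lower P {x, compl x} = {\<bottom>}"
    and Upper_compl: "x \<in> carrier P \<Longrightarrow> Upper P {x, compl x} = {\<top>}"
    and compl_antitone:
      "\<lbrakk>x \<in> carrier P; y \<in> carrier P; x \<sqsubseteq> y\<rbrakk> \<Longrightarrow> compl y \<sqsubseteq> compl x"
    and compl_involutive: "x \<in> carrier P \<Longrightarrow> compl (compl x) = x"

locale pseudo_orthomodular_poset = complementation_poset +
  assumes pseudo_orthomodular:
    "\<lbrakk>x \<in> carrier P; y \<in> carrier P\<rbrakk> \<Longrightarrow>
      Lower P (Upper P (Lower P {x, y} \<union> {compl y}) \<union> {y}) = Lower P {x, y}"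

end

theory Submission
  imports Defs
begin

text \<open>
  For \<open>z \<le> y\<close>, modularity gives \<open>L(U(z,y'),y) = L(U(z,L(y',y))) = L(U(z,0)) = L(z)\<close>, so the
  union on the right is just \<open>L(x,y)\<close>. The intersection on the left is \<open>U(L(x,y),y') \<union> {y}\<close>,
  and \<open>L(x,y)\<close> is always below \<open>L(U(L(x,y),y'),y)\<close>; hence the inclusion is pseudo-orthomodularity.
\<close>

context complementation_poset
begin

lemma modular_Lower_Upper_compl:
  assumes "modular_poset P" and y: "y \<in> carrier P" and z: "z \<in> carrier P" and "z \<sqsubseteq> y"
  shows "Lower P (Upper P {z, compl y} \<union> {y}) = Lower P {z}"
proof -
  have "Lower P (Upper P {z, compl y} \<union> {y}) = Lower P (Upper P ({z} \<union> Lower P {compl y, y}))"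
    using assms compl_closed by (intro modular_poset.modular) auto
  also have "Lower P {compl y, y} = {\<bottom>}"
    using Lower_compl[OF y] by (simp add: insert_commute)
  \<comment> \<open>Every element lies above \<open>\<bottom>\<close>, so the upper cone is that of
    \<open>z\<close> alone; it contains \<open>z\<close> as its least element.\<close>
  also have "Lower P (Upper P ({z} \<union> {\<bottom>})) = Lower P {z}"
    using z bottom_lower[OF z] bottom_closed
    by (auto simp: Lower_def Upper_def intro: le_trans)
  finally show ?thesis .
qed

lemma modular_UN_Lower:
  assumes "modular_poset P" and x: "x \<in> carrier P" and y: "y \<in> carrier P"
  shows "(\<Union>z\<in>Lower P {x, y}. Lower P (Upper P {z, compl y} \<union> {y})) = Lower P {x, y}"
proof -
  have "Lower P (Upper P {z, compl y} \<union> {y}) = Lower P {z}" if "z \<in> Lower P {x, y}" for z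
    using that y by (intro modular_Lower_Upper_compl assms) (auto simp: Lower_def)
  then have "(\<Union>z\<in>Lower P {x, y}. Lower P (Upper P {z, compl y} \<union> {y}))
      = (\<Union>z\<in>Lower P {x, y}. Lower P {z})"
    by simp
  \<comment> \<open>\<open>Lower P {x, y}\<close> is a down-set: transitivity gives one inclusion,
    and each element lies in its own lower cone.\<close>
  also have "\<dots> = Lower P {x, y}"
    using x y by (auto simp: Lower_def intro: le_trans)
  finally show ?thesis .
qed

lemma INT_Upper:
  assumes x: "x \<in> carrier P" and y: "y \<in> carrier P"
  shows "(\<Inter>z\<in>Lower P {x, y}. Upper P {z, compl y} \<union> {y})
    = Upper P (Lower P {x, y} \<union> {compl y}) \<union> {y}"
proof -
  \<comment> \<open>The index set must be nonempty: an empty intersection would be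
    \<open>UNIV\<close>, losing both the bound \<open>compl y\<close> and membership in the
    carrier.\<close>
  have "\<bottom> \<in> Lower P {x, y}"
    using x y bottom_lower bottom_closed by (auto simp: Lower_def)
  then show ?thesis
    using compl_closed[OF y] by (auto simp: Upper_def)
qed

text \<open>An element of a set lies below all upper bounds of any larger set; here it also lies
  below \<open>y\<close>.\<close>

lemma Lower_subset_Lower_Upper:
  assumes "x \<in> carrier P" and "y \<in> carrier P"
  shows "Lower P {x, y} \<subseteq> Lower P (Upper P (Lower P {x, y} \<union> {compl y}) \<union> {y})"
  using assms by (auto simp: Lower_def Upper_def)

end

theorem theorem4:
  fixes P :: "('a, 'b) gorder_scheme" and compl :: "'a \<Rightarrow> 'a"
  assumes "modular_poset P" and "complementation_poset P compl"
  shows "pseudo_orthomodular_poset P compl \<longleftrightarrow>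
    (\<forall>x\<in>carrier P. \<forall>y\<in>carrier P.
      Lower P (\<Inter>z\<in>Lower P {x, y}. Upper P {z, compl y} \<union> {y})
        \<subseteq> (\<Union>z\<in>Lower P {x, y}. Lower P (Upper P {z, compl y} \<union> {y})))"
proof -
  interpret complementation_poset P compl by fact
  have "pseudo_orthomodular_poset P compl \<longleftrightarrow>
    (\<forall>x\<in>carrier P. \<forall>y\<in>carrier P.
      Lower P (Upper P (Lower P {x, y} \<union> {compl y}) \<union> {y}) = Lower P {x, y})"
    using assms(2)
    by (simp add: pseudo_orthomodular_poset_def pseudo_orthomodular_poset_axioms_def Ball_def)
  also have "\<dots> \<longleftrightarrow> (\<forall>x\<in>carrier P. \<forall>y\<in>carrier P.
      Lower P (Upper P (Lower P {x, y} \<union> {compl y}) \<union> {y}) \<subseteq> Lower P {x, y})"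
    using Lower_subset_Lower_Upper by (simp add: set_eq_subset)
  finally show ?thesis
    \<comment> \<open>\<open>ball_cong\<close> supplies the carrier premises of both rewrite rules
      from the bounded quantifiers.\<close>
    by (simp only: INT_Upper modular_UN_Lower[OF assms(1)] cong: ball_cong)
qed

end
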